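(* A real Banach space $X$ is Hilbertian (that is, isomorphic to a real Hilbert space) if and only if there exists an invertible positive semidefinite linear operator $A:X\to X^*$.
   Context: $X^*$ is the dual of $X$, and $\langle x^*,x\rangle:=x^*(x)=:\langle x,x^*\rangle$ for $x^*\in X^*$, $x\in X$. An operator $A:X\to X^*$ is an invertible positive semidefinite linear operator if it is linear, continuous, invertible, symmetric (that is, $\langle Ax,y\rangle=\langle x,Ay\rangle$ for all $x,y\in X$), and satisfies $\langle Ax,x\rangle\geq 0$ for all $x\in X$. "Isomorphic" means that there is an invertible continuous linear operator (with continuous inverse) from $X$ onto a real Hilbert space. *)

theory Defs
  imports "HOL-Analysis.Analysis"
begin

section \<open>Real Hilbert spaces with an explicit carrier\<close>

text \<open>
  HOL cannot quantify existentially over types, so ``there is a real Hilbert space \<open>H\<close>'' cannot be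
  phrased with the type classes \<^class>\<open>real_inner\<close> and \<^class>\<open>complete_space\<close>.  A real Hilbert space
  is therefore a value: a carrier set together with its operations.
\<close>

record 'b inner_space =
  hcarrier :: "'b set"
  hadd :: "'b \<Rightarrow> 'b \<Rightarrow> 'b"
  hzero :: "'b"
  hscale :: "real \<Rightarrow> 'b \<Rightarrow> 'b"
  hinner :: "'b \<Rightarrow> 'b \<Rightarrow> real"

definition hnorm :: "'b inner_space \<Rightarrow> 'b \<Rightarrow> real"
  where "hnorm H x = sqrt (hinner H x x)"

text \<open>
  The value off the carrier is irrelevant; it is set to \<open>0\<close> because the locale \<^locale>\<open>Metric_space\<close> requires
  a distance to be symmetric and nonnegative on the whole type.
\<close>

definition hdist :: "'b inner_space \<Rightarrow> 'b \<Rightarrow> 'b \<Rightarrow> real"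
  where "hdist H x y =
    (if x \<in> hcarrier H \<and> y \<in> hcarrier H then hnorm H (hadd H x (hscale H (-1) y)) else 0)"

abbreviation htopology :: "'b inner_space \<Rightarrow> 'b topology"
  where "htopology H \<equiv> Metric_space.mtopology (hcarrier H) (hdist H)"

locale real_inner_product_space =
  fixes H :: "'b inner_space"
  assumes zero_closed: "hzero H \<in> hcarrier H"
    and add_closed: "\<lbrakk>x \<in> hcarrier H; y \<in> hcarrier H\<rbrakk> \<Longrightarrow> hadd H x y \<in> hcarrier H"
    and scale_closed: "x \<in> hcarrier H \<Longrightarrow> hscale H a x \<in> hcarrier H"
    and add_assoc: "\<lbrakk>x \<in> hcarrier H; y \<in> hcarrier H; z \<in> hcarrier H\<rbrakk>
          \<Longrightarrow> hadd H (hadd H x y) z = hadd H x (hadd H y z)"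
    and add_commute: "\<lbrakk>x \<in> hcarrier H; y \<in> hcarrier H\<rbrakk> \<Longrightarrow> hadd H x y = hadd H y x"
    and add_zero: "x \<in> hcarrier H \<Longrightarrow> hadd H x (hzero H) = x"
    and add_inverse: "x \<in> hcarrier H \<Longrightarrow> \<exists>y\<in>hcarrier H. hadd H x y = hzero H"
    and scale_add_right: "\<lbrakk>x \<in> hcarrier H; y \<in> hcarrier H\<rbrakk>
          \<Longrightarrow> hscale H a (hadd H x y) = hadd H (hscale H a x) (hscale H a y)"
    and scale_add_left: "x \<in> hcarrier H
          \<Longrightarrow> hscale H (a + b) x = hadd H (hscale H a x) (hscale H b x)"
    and scale_scale: "x \<in> hcarrier H \<Longrightarrow> hscale H a (hscale H b x) = hscale H (a * b) x"
    and scale_one: "x \<in> hcarrier H \<Longrightarrow> hscale H 1 x = x"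
    and inner_commute: "\<lbrakk>x \<in> hcarrier H; y \<in> hcarrier H\<rbrakk> \<Longrightarrow> hinner H x y = hinner H y x"
    and inner_add: "\<lbrakk>x \<in> hcarrier H; y \<in> hcarrier H; z \<in> hcarrier H\<rbrakk>
          \<Longrightarrow> hinner H (hadd H x y) z = hinner H x z + hinner H y z"
    and inner_scale: "\<lbrakk>x \<in> hcarrier H; y \<in> hcarrier H\<rbrakk>
          \<Longrightarrow> hinner H (hscale H a x) y = a * hinner H x y"
    and inner_nonneg: "x \<in> hcarrier H \<Longrightarrow> 0 \<le> hinner H x x"
    and inner_definite: "\<lbrakk>x \<in> hcarrier H; hinner H x x = 0\<rbrakk> \<Longrightarrow> x = hzero H"

locale real_hilbert_space = real_inner_product_space +
  assumes complete: "Metric_space.mcomplete (hcarrier H) (hdist H)"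

definition hilbert_isomorphism :: "'b inner_space \<Rightarrow> ('a::real_normed_vector \<Rightarrow> 'b) \<Rightarrow> bool"
  where "hilbert_isomorphism H T \<longleftrightarrow>
    (\<forall>x y. T (x + y) = hadd H (T x) (T y)) \<and>
    (\<forall>a x. T (a *\<^sub>R x) = hscale H a (T x)) \<and>
    (\<exists>S. homeomorphic_maps euclidean (htopology H) T S)"

text \<open>
  The underlying set of \<open>H\<close> is taken inside the type of \<open>X\<close>.  This is no restriction, because
  an isomorphism is in particular a bijection along which the structure of \<open>H\<close> can be transported: see
  \<open>hilbertianI\<close> and \<open>hilbertianI_type\<close> below.
\<close>

definition hilbertian :: "'a::banach itself \<Rightarrow> bool"
  where "hilbertian _ \<longleftrightarrow>
    (\<exists>(H :: 'a inner_space) (T :: 'a \<Rightarrow> 'a). real_hilbert_space H \<and> hilbert_isomorphism H T)"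

section \<open>Positive semidefinite operators into the dual\<close>

text \<open>
  The dual of \<open>'a\<close> is \<open>'a \<Rightarrow>\<^sub>L real\<close> with the operator norm; \<open>'a \<Rightarrow>\<^sub>L ('a \<Rightarrow>\<^sub>L real)\<close> consists of
  the continuous linear operators from the space into its dual.
\<close>

definition invertible_psd_operator :: "('a::banach \<Rightarrow>\<^sub>L ('a \<Rightarrow>\<^sub>L real)) \<Rightarrow> bool"
  where "invertible_psd_operator A \<longleftrightarrow>
    bij (blinfun_apply A) \<and>
    (\<forall>x y. blinfun_apply (blinfun_apply A x) y = blinfun_apply (blinfun_apply A y) x) \<and>
    (\<forall>x. blinfun_apply (blinfun_apply A x) x \<ge> 0)"

section \<open>Independence of the universe chosen for the Hilbert space\<close>

context real_inner_product_space
begin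

lemma inner_zero: "z \<in> hcarrier H \<Longrightarrow> hinner H (hzero H) z = 0"
  using inner_add[of "hzero H" "hzero H" z] add_zero zero_closed by simp

lemma scale_zero: "x \<in> hcarrier H \<Longrightarrow> hscale H 0 x = hzero H"
  by (intro inner_definite) (auto simp: inner_scale scale_closed)

lemma inner_add2: "\<lbrakk>x \<in> hcarrier H; y \<in> hcarrier H; z \<in> hcarrier H\<rbrakk>
    \<Longrightarrow> hinner H z (hadd H x y) = hinner H z x + hinner H z y"
  by (metis inner_add inner_commute add_closed)

lemma inner_scale2: "\<lbrakk>x \<in> hcarrier H; y \<in> hcarrier H\<rbrakk>
    \<Longrightarrow> hinner H y (hscale H a x) = a * hinner H y x"
  by (metis inner_scale inner_commute scale_closed)

lemmas inner_simps = inner_add inner_add2 inner_scale inner_scale2 add_closed scale_closed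

lemma Cauchy_Schwarz:
  assumes x: "x \<in> hcarrier H" and y: "y \<in> hcarrier H"
  shows "(hinner H x y)\<^sup>2 \<le> hinner H x x * hinner H y y"
proof (cases "hinner H y y = 0")
  case True
  then have "y = hzero H"
    using y inner_definite by blast
  then have "hinner H x y = 0"
    using x y inner_zero inner_commute by metis
  with True show ?thesis by simp
next
  case False
  define t where "t = - hinner H x y / hinner H y y"
  have pos: "hinner H y y > 0"
    using False inner_nonneg[OF y] by simp
  have "0 \<le> hinner H (hadd H x (hscale H t y)) (hadd H x (hscale H t y))"
    using x y by (intro inner_nonneg add_closed scale_closed)
  also have "\<dots> = hinner H x x + 2 * t * hinner H x y + t * t * hinner H y y"
    using x y by (simp add: inner_simps inner_commute[of y x] algebra_simps)
  also have "\<dots> = hinner H x x - (hinner H x y)\<^sup>2 / hinner H y y"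
    using pos by (simp add: t_def field_simps power2_eq_square)
  finally show ?thesis
    using pos by (simp add: field_simps)
qed

lemma diff_eq_zero:
  assumes x: "x \<in> hcarrier H" and y: "y \<in> hcarrier H"
    and 0: "hadd H x (hscale H (-1) y) = hzero H"
  shows "x = y"
proof -
  have "hadd H (hscale H (-1) y) y = hscale H (-1 + 1) y"
    using scale_add_left[OF y, of "-1" 1] scale_one[OF y] by simp
  also have "\<dots> = hzero H" using scale_zero[OF y] by simp
  finally have 1: "hadd H (hscale H (-1) y) y = hzero H" .
  have "x = hadd H x (hadd H (hscale H (-1) y) y)"
    using 1 x add_zero by simp
  also have "\<dots> = hadd H (hzero H) y"
    using 0 x y by (metis add_assoc scale_closed)
  also have "\<dots> = y"
    using y zero_closed add_commute add_zero by metis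
  finally show ?thesis .
qed

lemma Metric_space_hdist: "Metric_space (hcarrier H) (hdist H)"
proof
  have nn: "0 \<le> hinner H (hadd H x (hscale H (-1) y)) (hadd H x (hscale H (-1) y))"
    if "x \<in> hcarrier H" "y \<in> hcarrier H" for x y
    using that by (intro inner_nonneg add_closed scale_closed)
  show "0 \<le> hdist H x y" for x y
    by (simp add: hdist_def hnorm_def nn)
  show "hdist H x y = hdist H y x" for x y
    by (simp add: hdist_def hnorm_def inner_simps inner_commute[of x y] algebra_simps)
  show "hdist H x y = 0 \<longleftrightarrow> x = y" if x: "x \<in> hcarrier H" and y: "y \<in> hcarrier H" for x y
  proof
    assume "hdist H x y = 0"
    then have "hinner H (hadd H x (hscale H (-1) y)) (hadd H x (hscale H (-1) y)) = 0"
      using x y by (simp add: hdist_def hnorm_def)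
    then show "x = y"
      using x y by (intro diff_eq_zero[OF x y] inner_definite add_closed scale_closed)
  qed (use x y in \<open>simp add: hdist_def hnorm_def inner_simps\<close>)
  show "hdist H x z \<le> hdist H x y + hdist H y z"
    if x: "x \<in> hcarrier H" and y: "y \<in> hcarrier H" and z: "z \<in> hcarrier H" for x y z
  proof -
    define u v where "u = hadd H x (hscale H (-1) y)" and "v = hadd H y (hscale H (-1) z)"
    have uv: "u \<in> hcarrier H" "v \<in> hcarrier H"
      using x y z by (auto simp: u_def v_def add_closed scale_closed)
    have eq: "hinner H (hadd H x (hscale H (-1) z)) (hadd H x (hscale H (-1) z)) =
        hinner H u u + 2 * hinner H u v + hinner H v v"
      using x y z by (simp add: u_def v_def inner_simps inner_commute[of y x]
          inner_commute[of z x] inner_commute[of z y])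
    have "\<bar>hinner H u v\<bar> \<le> sqrt (hinner H u u * hinner H v v)"
      using Cauchy_Schwarz[OF uv] by (rule real_le_rsqrt[of "\<bar>_\<bar>", simplified])
    then have "hinner H u u + 2 * hinner H u v + hinner H v v
        \<le> (sqrt (hinner H u u) + sqrt (hinner H v v))\<^sup>2"
      using inner_nonneg[OF uv(1)] inner_nonneg[OF uv(2)]
      by (simp add: power2_sum real_sqrt_mult)
    then have "sqrt (hinner H u u + 2 * hinner H u v + hinner H v v)
        \<le> sqrt (hinner H u u) + sqrt (hinner H v v)"
      using inner_nonneg[OF uv(1)] inner_nonneg[OF uv(2)] by (intro real_le_lsqrt) auto
    then show ?thesis
      using x y z eq by (simp add: hdist_def hnorm_def u_def v_def)
  qed
qed

end

lemma hilbertianI: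
  fixes H :: "'b inner_space" and T :: "'a::banach \<Rightarrow> 'b"
  assumes H: "real_hilbert_space H" and T: "hilbert_isomorphism H T"
  shows "hilbertian TYPE('a)"
proof -
  interpret H: real_hilbert_space H by (rule H)
  define K :: "'a inner_space" where
    "K = \<lparr>hcarrier = UNIV, hadd = (+), hzero = 0, hscale = (*\<^sub>R),
          hinner = (\<lambda>x y. hinner H (T x) (T y))\<rparr>"
  from T obtain S where add: "\<And>x y. T (x + y) = hadd H (T x) (T y)"
    and scale: "\<And>a x. T (a *\<^sub>R x) = hscale H a (T x)"
    and S: "homeomorphic_maps euclidean (htopology H) T S"
    unfolding hilbert_isomorphism_def by blast
  interpret MH: Metric_space "hcarrier H" "hdist H" by (rule H.Metric_space_hdist)
  have Tc: "T x \<in> hcarrier H" for x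
    using S by (auto simp: homeomorphic_maps_def continuous_map_def Pi_iff)
  have ST: "S (T x) = x" for x
    using S by (auto simp: homeomorphic_maps_def)
  have TS: "T (S y) = y" if "y \<in> hcarrier H" for y
    using S that by (auto simp: homeomorphic_maps_def)
  have T0: "T 0 = hzero H"
    using scale[of 0 0] H.scale_zero[OF Tc] by simp
  have K: "real_inner_product_space K"
  proof
    fix x assume "hinner K x x = 0"
    then have "T x = T 0"
      using H.inner_definite[OF Tc] T0 by (simp add: K_def)
    then have "x = 0" by (metis ST)
    then show "x = hzero K" by (simp add: K_def)
  next
    fix x assume "x \<in> hcarrier K"
    show "\<exists>y\<in>hcarrier K. hadd K x y = hzero K"
      by (intro bexI[of _ "- x"]) (auto simp: K_def)
  qed (auto simp: K_def add scale Tc H.inner_simps H.inner_nonneg H.inner_commute algebra_simps)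
  interpret K: real_inner_product_space K by (rule K)
  interpret MK: Metric_space "hcarrier K" "hdist K" by (rule K.Metric_space_hdist)
  have UK: "hcarrier K = UNIV" by (simp add: K_def)
  have dist: "hdist H (T x) (T y) = hdist K x y" for x y
    using Tc add[of x "(-1) *\<^sub>R y"] scale[of "-1" y]
    by (simp add: hdist_def hnorm_def K_def)
  interpret KH: Metric_space12 "hcarrier K" "hdist K" "hcarrier H" "hdist H" ..
  have img: "T ` hcarrier K = hcarrier H"
    proof
    show "hcarrier H \<subseteq> T ` hcarrier K"
    proof
      fix y assume "y \<in> hcarrier H"
      from TS[OF this] show "y \<in> T ` hcarrier K" unfolding UK by (metis rangeI)
    qed
  qed (use Tc in auto)
  have "homeomorphic_map (htopology K) (htopology H) T"
    using img dist by (intro KH.isometry_imp_homeomorphic_map) auto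
  then obtain S' where S': "homeomorphic_maps (htopology K) (htopology H) T S'"
    using homeomorphic_map_maps by blast
  have SS': "S' y = S y" if "y \<in> hcarrier H" for y
    proof -
    have "S' (T (S y)) = S y"
      using S' UK MK.topspace_mtopology by (simp add: homeomorphic_maps_def)
    then show ?thesis by (simp only: TS[OF that])
  qed
  have "homeomorphic_maps euclidean (htopology K) (S' \<circ> T) (S \<circ> T)"
    by (rule homeomorphic_maps_compose[OF conjI[OF S S'[THEN homeomorphic_maps_sym[THEN iffD1]]]])
  then have hom: "homeomorphic_maps euclidean (htopology K) (\<lambda>x. x) (\<lambda>x. x)"
    by (simp only: o_def SS'[OF Tc] ST)
  have "MK.mcomplete"
    unfolding MK.mcomplete_def
  proof (intro allI impI)
    fix \<sigma> assume "MK.MCauchy \<sigma>"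
    then have "MH.MCauchy (T \<circ> \<sigma>)"
      by (auto simp: MK.MCauchy_def MH.MCauchy_def dist Tc)
    then obtain l where "limitin (htopology H) (T \<circ> \<sigma>) l sequentially"
      using H.complete MH.mcomplete_def by blast
    then have l: "l \<in> hcarrier H" and
      "\<And>\<epsilon>. \<epsilon> > 0 \<Longrightarrow> eventually (\<lambda>n. hdist H (T (\<sigma> n)) l < \<epsilon>) sequentially"
      by (auto simp: MH.limitin_metric Tc)
    then have "\<And>\<epsilon>. \<epsilon> > 0 \<Longrightarrow> eventually (\<lambda>n. hdist K (\<sigma> n) (S l) < \<epsilon>) sequentially"
      unfolding dist[symmetric] TS[OF l] by blast
    then have "limitin (htopology K) \<sigma> (S l) sequentially"
      unfolding MK.limitin_metric by (simp add: UK)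
    then show "\<exists>x. limitin (htopology K) \<sigma> x sequentially" ..
  qed
  then have "real_hilbert_space K"
    by unfold_locales
  moreover have "hilbert_isomorphism K (\<lambda>x. x)"
    using hom by (auto simp: hilbert_isomorphism_def K_def)
  ultimately show ?thesis
    unfolding hilbertian_def by blast
qed

lemma hilbertianI_type:
  fixes T :: "'a::banach \<Rightarrow> 'h::{real_inner, complete_space}"
  assumes "linear T" and "homeomorphism UNIV UNIV T S"
  shows "hilbertian TYPE('a)"
proof (rule hilbertianI)
  define H :: "'h inner_space" where
    "H = \<lparr>hcarrier = UNIV, hadd = (+), hzero = 0, hscale = (*\<^sub>R), hinner = (\<bullet>)\<rparr>"
  have d: "hdist H = dist"
    by (intro ext) (simp add: hdist_def hnorm_def H_def dist_norm norm_eq_sqrt_inner)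
  have U: "hcarrier H = UNIV" by (simp add: H_def)
  show "real_hilbert_space H"
  proof
    fix x assume "x \<in> hcarrier H"
    show "\<exists>y\<in>hcarrier H. hadd H x y = hzero H"
      by (intro bexI[of _ "- x"]) (auto simp: H_def)
  next
    show "Metric_space.mcomplete (hcarrier H) (hdist H)"
      unfolding d U mcomplete_iff_complete by (rule complete_UNIV)
  qed (auto simp: H_def algebra_simps inner_commute)
  have "homeomorphic_maps euclidean (htopology H) T S"
    using assms(2) by (simp add: d U homeomorphic_maps_def homeomorphism_def)
  then show "hilbert_isomorphism H T"
    using assms(1) by (auto simp: hilbert_isomorphism_def H_def linear_add linear_scale)
qed

end

theory Submission
  imports Defs
begin

text \<open>
  A continuous operator \<open>A\<close> from \<open>X\<close> into its dual is the same thing as a bounded bilinear form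
  \<open>(x, y) \<mapsto> A x y\<close>.  Both sides of the equivalence say that \<open>X\<close> carries a symmetric bounded form
  that is coercive, \<open>c * (norm x)\<^sup>2 \<le> A x x\<close> for some \<open>c > 0\<close>: such a form is exactly an inner
  product whose norm is equivalent to the norm of \<open>X\<close>.

  An isomorphism \<open>T\<close> onto a Hilbert space pulls the inner product back to such a form, since \<open>T\<close> and
  its inverse, being continuous at \<open>0\<close>, are bounded (\<open>hilbertian_imp_coercive\<close>); conversely, \<open>X\<close>
  renormed by a coercive form is a Hilbert space with the same topology
  (\<open>coercive_imp_hilbertian\<close>).

  A symmetric coercive form is invertible as an operator into the dual: injectivity is clear, and
  surjectivity is the Riesz representation theorem for the inner product that it defines
  (\<open>coercive_imp_surj\<close>).  Conversely, let \<open>A\<close> be invertible, symmetric and positive semidefinite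
  (\<open>invertible_psd_imp_coercive\<close>).  By the open mapping theorem (\<open>bounded_solutions\<close>) there is \<open>C\<close>
  with \<open>norm x \<le> C * norm (A x)\<close>, and by the Cauchy-Schwarz inequality for the form,
  \<open>\<bar>A x y\<bar>\<^sup>2 \<le> A x x * A y y \<le> A x x * norm A * (norm y)\<^sup>2\<close>, so that
  \<open>(norm (A x))\<^sup>2 \<le> norm A * A x x\<close>.  Together, \<open>(norm x)\<^sup>2 \<le> C\<^sup>2 * norm A * A x x\<close>.
\<close>

section \<open>The open mapping theorem for bounded linear operators\<close>

text \<open>
  The category argument in the open mapping theorem.  Completeness of the codomain makes the closure
  of the image of some ball contain a ball, say around \<open>y0\<close>; halving the difference of approximate
  preimages of \<open>y0 + y\<close> and \<open>y0 - y\<close> moves the centre to \<open>0\<close>, and scaling does the rest.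
  The error \<open>norm y / 2\<close> is what makes the iteration in \<open>bounded_solutions\<close> converge.
\<close>

lemma approximate_solutions:
  fixes A :: "'a::real_normed_vector \<Rightarrow>\<^sub>L 'b::banach"
  assumes "surj A"
  shows "\<exists>M>0. \<forall>y. \<exists>x. norm x \<le> M * norm y \<and> norm (y - A x) \<le> norm y / 2"
proof -
  define F where "F n = closure (A ` cball 0 (real n))" for n
  have "\<exists>n. interior (F n) \<noteq> {}"
  proof (rule ccontr)
    assume "\<not> ?thesis"
    then have nowhere_dense: "closed T \<and> interior T = {}" if "T \<in> range F" for T
      using that by (auto simp: F_def)
    have "Met_TC.mtopology interior_of \<Union>(range F) = {}"
      by (rule Met_TC.metric_Baire_category_alt)
         (simp_all add: nowhere_dense mcomplete_iff_complete complete_UNIV)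
    then have "interior (\<Union>(range F)) = {}"
      by (simp add: Met_TC.mtopology_def)
    moreover have "\<Union>(range F) = UNIV"
    proof -
      have "y \<in> \<Union>(range F)" for y
      proof -
        obtain x where "y = A x" using assms by auto
        moreover obtain n where "norm x \<le> real n" using real_arch_simple by blast
        ultimately show ?thesis
          unfolding F_def using closure_subset by fastforce
      qed
      then show ?thesis by blast
    qed
    ultimately show False by simp
  qed
  then obtain n y0 where "y0 \<in> interior (F n)" by blast
  then obtain r where r: "r > 0" "ball y0 r \<subseteq> F n"
    by (meson mem_interior)
  have near: "\<exists>x. norm x \<le> real n \<and> norm (y - A x) < e" if "norm (y - y0) < r" "e > 0" for y e
  proof -
    have "y \<in> F n" using r that by (auto simp: dist_norm norm_minus_commute)
    then obtain z where "z \<in> A ` cball 0 (real n)" "dist z y < e"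
      unfolding F_def using \<open>e > 0\<close> closure_approachable by blast
    then show ?thesis by (auto simp: dist_norm norm_minus_commute)
  qed
  have small: "\<exists>x. norm x \<le> real n \<and> norm (y - A x) < e" if y: "norm y < r" and e: "e > 0" for y e
  proof -
    obtain u where u: "norm u \<le> real n" "norm (y0 + y - A u) < e"
      using near[of "y0 + y" e] y e by auto
    obtain v where v: "norm v \<le> real n" "norm (y0 - y - A v) < e"
      using near[of "y0 - y" e] y e by auto
    have diff: "(y0 + y - A u) - (y0 - y - A v) = 2 *\<^sub>R y - A (u - v)"
      by (simp add: blinfun.diff_right scaleR_2)
    have eq: "y - A ((1/2) *\<^sub>R (u - v)) = (1/2) *\<^sub>R ((y0 + y - A u) - (y0 - y - A v))"
      unfolding diff by (simp add: blinfun.bilinear_simps algebra_simps)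
    have "norm ((y0 + y - A u) - (y0 - y - A v)) < 2 * e"
      using u v norm_triangle_ineq4[of "y0 + y - A u" "y0 - y - A v"] by linarith
    then have "norm (y - A ((1/2) *\<^sub>R (u - v))) < e"
      unfolding eq norm_scaleR by simp
    moreover have "norm ((1/2) *\<^sub>R (u - v)) \<le> real n"
      using u v norm_triangle_ineq4[of u v] by simp
    ultimately show ?thesis by blast
  qed
  define M where "M = 2 * real n / r + 1"
  show ?thesis
  proof (intro exI[of _ M] conjI allI)
    show "M > 0" using r by (simp add: M_def add_nonneg_pos)
    fix y
    show "\<exists>x. norm x \<le> M * norm y \<and> norm (y - A x) \<le> norm y / 2"
    proof (cases "y = 0")
      case True
      then show ?thesis by (auto intro!: exI[of _ 0])
    next
      case False
      define s where "s = r / (2 * norm y)"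
      have s: "s > 0" using False r by (simp add: s_def)
      have "norm (s *\<^sub>R y) < r" using False r by (simp add: s_def)
      then obtain x where x: "norm x \<le> real n" "norm (s *\<^sub>R y - A x) < s * (norm y / 2)"
        using small[of "s *\<^sub>R y" "s * (norm y / 2)"] s False by auto
      have "s *\<^sub>R y - A x = s *\<^sub>R (y - A ((1/s) *\<^sub>R x))"
        using s by (simp add: blinfun.bilinear_simps algebra_simps)
      then have "s * norm (y - A ((1/s) *\<^sub>R x)) < s * (norm y / 2)"
        using x(2) s by simp
      then have "norm (y - A ((1/s) *\<^sub>R x)) \<le> norm y / 2"
        using s by simp
      moreover have "norm ((1/s) *\<^sub>R x) \<le> real n / s"
        using x(1) s by (simp add: divide_right_mono)
      moreover have "real n / s = (2 * real n / r) * norm y"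
        using r by (simp add: s_def)
      ultimately show ?thesis
        by (intro exI[of _ "(1/s) *\<^sub>R x"]) (auto simp: M_def distrib_right intro: order_trans)
    qed
  qed
qed

text \<open>
  Solving approximately for the remaining error again and again gives corrections that decay
  geometrically; they sum up to an exact solution because the domain is complete.
\<close>

lemma bounded_solutions:
  fixes A :: "'a::banach \<Rightarrow>\<^sub>L 'b::banach"
  assumes "surj A"
  shows "\<exists>C>0. \<forall>y. \<exists>x. A x = y \<and> norm x \<le> C * norm y"
proof -
  obtain M where M: "M > 0"
    and "\<forall>y. \<exists>x. norm x \<le> M * norm y \<and> norm (y - A x) \<le> norm y / 2"
    using approximate_solutions[OF assms] by blast
  then obtain g where g: "\<And>y. norm (g y) \<le> M * norm y" "\<And>y. norm (y - A (g y)) \<le> norm y / 2"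
    by metis
  show ?thesis
  proof (intro exI[of _ "2 * M"] conjI allI)
    show "2 * M > 0" using M by simp
    fix y
    \<comment> \<open>\<open>\<rho> k\<close> is the error left after \<open>k\<close> corrections.\<close>
    define \<rho> where "\<rho> k = ((\<lambda>z. z - A (g z)) ^^ k) y" for k
    have \<rho>: "\<rho> 0 = y" "\<rho> (Suc k) = \<rho> k - A (g (\<rho> k))" for k
      by (simp_all add: \<rho>_def)
    have \<rho>_le: "norm (\<rho> k) \<le> norm y * (1/2) ^ k" for k
    proof (induction k)
      case (Suc k)
      then show ?case using g(2)[of "\<rho> k"] by (simp add: \<rho>(2))
    qed (simp add: \<rho>)
    have g_le: "norm (g (\<rho> k)) \<le> M * norm y * (1/2) ^ k" for k
      using order_trans[OF g(1) mult_left_mono[OF \<rho>_le less_imp_le[OF M]]]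
      by (simp only: mult.assoc)
    have geo: "(\<lambda>k. M * norm y * (1/2) ^ k) sums (M * norm y * 2)"
      using sums_mult[OF geometric_sums[of "1/2::real"], of "M * norm y"] by simp
    have sn: "summable (\<lambda>k. norm (g (\<rho> k)))"
      by (rule summable_comparison_test'[OF sums_summable[OF geo]]) (simp add: g_le)
    then have sg: "summable (\<lambda>k. g (\<rho> k))" by (rule summable_norm_cancel)
    define x where "x = (\<Sum>k. g (\<rho> k))"
    have "norm x \<le> (\<Sum>k. norm (g (\<rho> k)))"
      unfolding x_def by (rule summable_norm[OF sn])
    also have "\<dots> \<le> M * norm y * 2"
      using suminf_le[OF g_le sn sums_summable[OF geo]] sums_unique[OF geo] by simp
    finally have "norm x \<le> 2 * M * norm y" by simp
    moreover have "A x = y"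
    proof -
      have "(\<lambda>k. A (g (\<rho> k))) sums A x"
        unfolding x_def
        by (intro bounded_linear.sums[OF blinfun.bounded_linear_right] summable_sums sg)
      moreover have "\<rho> \<longlonglongrightarrow> 0"
        by (rule Lim_null_comparison[OF always_eventually[OF allI[OF \<rho>_le]]])
           (auto intro!: tendsto_mult_right_zero LIMSEQ_power_zero)
      then have "(\<lambda>k. \<rho> k - \<rho> (Suc k)) sums (\<rho> 0 - 0)"
        by (rule telescope_sums')
      then have "(\<lambda>k. A (g (\<rho> k))) sums y" by (simp add: \<rho>)
      ultimately show ?thesis using sums_unique2 by blast
    qed
    ultimately show "\<exists>x. A x = y \<and> norm x \<le> 2 * M * norm y" by blast
  qed
qed

section \<open>Invertible positive semidefinite operators and coercive forms\<close>

text \<open>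
  The form may a priori be degenerate.  If \<open>A y y = 0\<close>, the values of \<open>A z z\<close> for \<open>z\<close> on the line
  through \<open>x\<close> in direction \<open>y\<close> are affine and bounded below, which forces \<open>A x y = 0\<close>.
\<close>

lemma psd_Cauchy_Schwarz:
  fixes A :: "'a::real_normed_vector \<Rightarrow>\<^sub>L ('a \<Rightarrow>\<^sub>L real)"
  assumes sym: "\<And>x y. A x y = A y x" and psd: "\<And>x. A x x \<ge> 0"
  shows "(A x y)\<^sup>2 \<le> A x x * A y y"
proof -
  have *: "0 \<le> A x x + 2 * t * A x y + t\<^sup>2 * A y y" for t
    using psd[of "x + t *\<^sub>R y"] sym[of y x]
    by (simp add: blinfun.bilinear_simps power2_eq_square algebra_simps)
  show ?thesis
  proof (cases "A y y = 0")
    case True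
    have "A x y = 0"
    proof (rule ccontr)
      assume "A x y \<noteq> 0"
      then show False
        using *[of "- (A x x + 1) / (2 * A x y)"] True by (simp add: field_simps)
    qed
    then show ?thesis using True by simp
  next
    case False
    then have "A y y > 0" using psd[of y] by simp
    then show ?thesis
      using *[of "- A x y / A y y"] by (simp add: power2_eq_square field_simps)
  qed
qed

definition coercive :: "('a::real_normed_vector \<Rightarrow>\<^sub>L ('a \<Rightarrow>\<^sub>L real)) \<Rightarrow> bool"
  where "coercive A \<longleftrightarrow> (\<exists>c>0. \<forall>x. c * (norm x)\<^sup>2 \<le> A x x)"

lemma coerciveE:
  assumes "coercive A"
  obtains c where "c > 0" "\<And>x. c * (norm x)\<^sup>2 \<le> A x x" "\<And>x. A x x \<ge> 0"
proof -
  obtain c where c: "c > 0" "\<And>x. c * (norm x)\<^sup>2 \<le> A x x"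
    using assms by (auto simp: coercive_def)
  have "A x x \<ge> 0" for x
    using c(2)[of x] c(1) by (meson mult_nonneg_nonneg less_imp_le zero_le_power2 order_trans)
  with c show ?thesis by (rule that)
qed

text \<open>
  Invertibility gives the lower bound \<open>norm x \<le> C * norm (A x)\<close>, and positivity turns it into a
  bound by \<open>A x x\<close>, because by Cauchy-Schwarz \<open>A x\<close> is small in norm whenever \<open>A x x\<close> is small.
\<close>

lemma invertible_psd_imp_coercive:
  fixes A :: "'a::banach \<Rightarrow>\<^sub>L ('a \<Rightarrow>\<^sub>L real)"
  assumes "invertible_psd_operator A"
  shows "coercive A"
proof -
  have sym: "\<And>x y. A x y = A y x" and psd: "\<And>x. A x x \<ge> 0" and "bij A"
    using assms by (auto simp: invertible_psd_operator_def)
  obtain C where C: "C > 0" "\<And>f. \<exists>x. A x = f \<and> norm x \<le> C * norm f"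
    using bounded_solutions[of A] \<open>bij A\<close> bij_is_surj by blast
  have lower: "norm x \<le> C * norm (A x)" for x
    using C(2)[of "A x"] bij_is_inj[OF \<open>bij A\<close>] by (auto dest: injD)
  have upper: "(norm (A x))\<^sup>2 \<le> norm A * A x x" for x
  proof -
    have "norm (A x y) \<le> sqrt (norm A * A x x) * norm y" for y
    proof -
      have "A y y \<le> norm A * norm y * norm y"
        using norm_blinfun[of "A y" y] mult_right_mono[OF norm_blinfun[of A y], of "norm y"]
        by simp
      then have "A x x * A y y \<le> A x x * (norm A * norm y * norm y)"
        using psd by (rule mult_left_mono)
      with psd_Cauchy_Schwarz[of A x y, OF sym psd]
      have "(A x y)\<^sup>2 \<le> (sqrt (norm A * A x x) * norm y)\<^sup>2"
        using psd[of x] by (simp add: power_mult_distrib power2_eq_square mult_ac)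
      then show ?thesis
        using psd[of x] by (simp add: abs_le_square_iff[symmetric] abs_mult)
    qed
    then have "norm (A x) \<le> sqrt (norm A * A x x)"
      by (intro norm_blinfun_bound) (simp_all add: psd)
    then show ?thesis
      using psd[of x] by (metis norm_ge_zero mult_nonneg_nonneg real_sqrt_pow2 power_mono)
  qed
  \<comment> \<open>The summand 1 keeps \<open>D\<close> positive when \<open>A = 0\<close>, that is, on the zero space.\<close>
  define D where "D = C\<^sup>2 * norm A + 1"
  have "D > 0" by (simp add: D_def add_nonneg_pos)
  have "(norm x)\<^sup>2 \<le> D * A x x" for x
  proof -
    have "(norm x)\<^sup>2 \<le> (C * norm (A x))\<^sup>2" using lower by (simp add: power_mono)
    also have "\<dots> \<le> C\<^sup>2 * (norm A * A x x)"
      using upper by (simp add: power_mult_distrib mult_left_mono)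
    also have "\<dots> \<le> D * A x x" using psd[of x] by (simp add: D_def distrib_right)
    finally show ?thesis .
  qed
  then show ?thesis
    unfolding coercive_def using \<open>D > 0\<close>
    by (intro exI[of _ "1 / D"]) (simp add: field_simps)
qed

text \<open>
  The Riesz representation theorem by Dirichlet's principle: the quadratic functional
  \<open>J x = A x x - 2 * f x\<close> is bounded below by coercivity, minimizing sequences are Cauchy by the
  parallelogram law, and the vanishing of the first variation at a minimizer \<open>x\<close> is the equation
  \<open>A x = f\<close>.
\<close>

lemma coercive_imp_surj:
  fixes A :: "'a::banach \<Rightarrow>\<^sub>L ('a \<Rightarrow>\<^sub>L real)"
  assumes sym: "\<And>x y. A x y = A y x" and "coercive A"
  shows "surj A"
proof -
  obtain c where c: "c > 0" "\<And>x. c * (norm x)\<^sup>2 \<le> A x x" "\<And>x. A x x \<ge> 0"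
    using \<open>coercive A\<close> by (rule coerciveE) blast
  have "\<exists>x. f = A x" for f :: "'a \<Rightarrow>\<^sub>L real"
  proof -
    define J where "J x = A x x - 2 * f x" for x
    have lower: "J x \<ge> - (norm f)\<^sup>2 / c" for x
    proof -
      have "f x \<le> norm f * norm x" using norm_blinfun[of f x] by simp
      then have "J x \<ge> c * (norm x)\<^sup>2 - 2 * (norm f * norm x)"
        unfolding J_def using c(2)[of x] by linarith
      moreover have "c * (norm x)\<^sup>2 - 2 * (norm f * norm x) + (norm f)\<^sup>2 / c
          = c * (norm x - norm f / c)\<^sup>2"
        using c(1) by (simp add: power2_eq_square field_simps)
      ultimately show ?thesis
        using c(1) by (smt (verit) mult_nonneg_nonneg zero_le_power2 minus_divide_left)
    qed
    then have bdd: "bdd_below (range J)" by (intro bdd_belowI[of _ "- (norm f)\<^sup>2 / c"]) auto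
    define m where "m = Inf (range J)"
    have m: "m \<le> J x" for x unfolding m_def using bdd by (simp add: cInf_lower)
    have "\<exists>x. J x < m + inverse (real (Suc n))" for n
      using cInf_lessD[of "range J" "m + inverse (real (Suc n))"]
      by (auto simp: m_def)
    then obtain X where X: "\<And>n. J (X n) < m + inverse (real (Suc n))" by metis
    have conv: "c * (norm (u - v))\<^sup>2 \<le> 2 * (J u + J v - 2 * m)" for u v
    proof -
      have "J u + J v = 2 * J ((1/2) *\<^sub>R (u + v)) + A (u - v) (u - v) / 2"
        using sym[of u v] by (simp add: J_def blinfun.bilinear_simps field_simps)
      then show ?thesis using m[of "(1/2) *\<^sub>R (u + v)"] c(2)[of "u - v"] by simp
    qed
    have "Cauchy X"
    proof (rule metric_CauchyI)
      fix e :: real assume "e > 0"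
      then obtain N where N: "inverse (real (Suc N)) < c * e\<^sup>2 / 4"
        using c(1) reals_Archimedean[of "c * e\<^sup>2 / 4"] by auto
      have near: "J (X n) < m + c * e\<^sup>2 / 4" if "n \<ge> N" for n
      proof -
        have "inverse (real (Suc n)) \<le> inverse (real (Suc N))" using that by simp
        then show ?thesis using X[of n] N by linarith
      qed
      have "dist (X i) (X j) < e" if "i \<ge> N" "j \<ge> N" for i j
      proof -
        have "c * (norm (X i - X j))\<^sup>2 < c * e\<^sup>2"
          using conv[of "X i" "X j"] near[OF that(1)] near[OF that(2)] by argo
        then show ?thesis
          using c(1) \<open>e > 0\<close> by (simp add: dist_norm power_less_imp_less_base)
      qed
      then show "\<exists>M. \<forall>i\<ge>M. \<forall>j\<ge>M. dist (X i) (X j) < e" by blast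
    qed
    then obtain x where x: "X \<longlonglongrightarrow> x" using Cauchy_convergent convergent_def by blast
    have "(\<lambda>n. J (X n)) \<longlonglongrightarrow> J x"
      unfolding J_def by (intro tendsto_intros x)
    moreover have "(\<lambda>n. m + inverse (real (Suc n))) \<longlonglongrightarrow> m"
      using LIMSEQ_inverse_real_of_nat_add by blast
    ultimately have "J x \<le> m"
      using LIMSEQ_le X by (meson less_imp_le)
    have "f y = A x y" for y
    proof (rule ccontr)
      assume "f y \<noteq> A x y"
      define d where "d = f y - A x y"
      have "d \<noteq> 0" using \<open>f y \<noteq> A x y\<close> by (simp add: d_def)
      have *: "2 * t * d \<le> t\<^sup>2 * A y y" for t
        using m[of "x + t *\<^sub>R y"] \<open>J x \<le> m\<close> sym[of y x]
        by (simp add: J_def d_def blinfun.bilinear_simps power2_eq_square algebra_simps)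
      \<comment> \<open>For small \<open>t\<close> of the sign of \<open>d\<close> the linear term beats the quadratic one;
        adding 1 to \<open>A y y\<close> avoids a case distinction on \<open>y = 0\<close>.\<close>
      define k where "k = A y y + 1"
      have k: "k > 0" "A y y \<le> k" using c(3)[of y] by (auto simp: k_def)
      have "2 * (d\<^sup>2 / k) = 2 * (d / k) * d" by (simp add: power2_eq_square)
      also have "\<dots> \<le> (d / k)\<^sup>2 * A y y" by (rule *)
      also have "\<dots> \<le> (d / k)\<^sup>2 * k" using k(2) by (intro mult_left_mono) auto
      also have "\<dots> = d\<^sup>2 / k" using k(1) by (simp add: power2_eq_square)
      finally have "d\<^sup>2 / k \<le> 0" by simp
      moreover have "d\<^sup>2 / k > 0" using \<open>d \<noteq> 0\<close> k(1) by simp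
      ultimately show False by simp
    qed
    then show ?thesis by (auto intro: blinfun_eqI)
  qed
  then show ?thesis by (simp add: surj_def)
qed

lemma coercive_imp_invertible_psd:
  fixes A :: "'a::banach \<Rightarrow>\<^sub>L ('a \<Rightarrow>\<^sub>L real)"
  assumes sym: "\<And>x y. A x y = A y x" and "coercive A"
  shows "invertible_psd_operator A"
proof -
  obtain c where c: "c > 0" "\<And>x. c * (norm x)\<^sup>2 \<le> A x x" "\<And>x. A x x \<ge> 0"
    using \<open>coercive A\<close> by (rule coerciveE) blast
  have "inj A"
  proof (rule injI)
    fix x y assume "A x = A y"
    then have "A (x - y) (x - y) = 0" by (simp add: blinfun.bilinear_simps)
    then show "x = y" using c(2)[of "x - y"] c(1) by (simp add: mult_le_0_iff)
  qed
  then show ?thesis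
    using coercive_imp_surj[OF assms] c(3) sym by (simp add: invertible_psd_operator_def bij_def)
qed

section \<open>Hilbertian spaces and coercive forms\<close>

text \<open>
  This is ``continuous at \<open>0\<close> implies bounded'' for linear maps, stated for two seminorms so that it
  applies to an isomorphism and to its inverse alike.
\<close>

lemma homogeneous_bound:
  fixes p q :: "'a::real_vector \<Rightarrow> real"
  assumes p: "\<And>a x. p (a *\<^sub>R x) = \<bar>a\<bar> * p x" "\<And>x. p x \<ge> 0"
    and q: "\<And>a x. q (a *\<^sub>R x) = \<bar>a\<bar> * q x" "\<And>x. q x \<ge> 0"
    and le: "\<And>x. p x < e \<Longrightarrow> q x < 1"
  shows "e * q x \<le> p x"
proof (cases "q x = 0")
  case False
  then have "q x > 0" using q(2)[of x] by simp
  moreover have "q ((1 / q x) *\<^sub>R x) = 1" using \<open>q x > 0\<close> q(1) by simp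
  then have "e \<le> p ((1 / q x) *\<^sub>R x)" using le[of "(1 / q x) *\<^sub>R x"] by force
  ultimately show ?thesis using p(1) by (simp add: field_simps)
qed (simp add: p)

text \<open>
  The form is the inner product of the Hilbert space, pulled back along the isomorphism.  Its
  boundedness expresses continuity of the isomorphism, its coercivity continuity of the inverse.
\<close>

lemma hilbertian_imp_coercive:
  assumes "hilbertian TYPE('a::banach)"
  shows "\<exists>A :: 'a \<Rightarrow>\<^sub>L ('a \<Rightarrow>\<^sub>L real). coercive A \<and>
    (\<forall>x y. blinfun_apply (blinfun_apply A x) y = blinfun_apply (blinfun_apply A y) x)"
proof -
  obtain H :: "'a inner_space" and T :: "'a \<Rightarrow> 'a" where H: "real_hilbert_space H"
    and T: "hilbert_isomorphism H T"
    using assms by (auto simp: hilbertian_def)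
  interpret H: real_hilbert_space H by (rule H)
  interpret MH: Metric_space "hcarrier H" "hdist H" by (rule H.Metric_space_hdist)
  from T obtain S where add: "\<And>x y. T (x + y) = hadd H (T x) (T y)"
    and scale: "\<And>a x. T (a *\<^sub>R x) = hscale H a (T x)"
    and S: "homeomorphic_maps euclidean (htopology H) T S"
    unfolding hilbert_isomorphism_def by blast
  have Tc: "T x \<in> hcarrier H" for x
    using S by (auto simp: homeomorphic_maps_def continuous_map_def Pi_iff)
  have ST: "S (T x) = x" for x
    using S by (auto simp: homeomorphic_maps_def)
  have contT: "continuous_map euclidean (htopology H) T"
    and contS: "continuous_map (htopology H) euclidean S"
    using S by (auto simp: homeomorphic_maps_def)
  define b where "b x y = hinner H (T x) (T y)" for x y
  define p where "p x = sqrt (b x x)" for x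
  have b_add: "b (x + y) z = b x z + b y z" and b_scale: "b (a *\<^sub>R x) z = a * b x z"
    and b_sym: "b x y = b y x" and b_nonneg: "b x x \<ge> 0" for x y z a
    by (simp_all add: b_def add scale Tc H.inner_simps H.inner_nonneg H.inner_commute)
  have p: "p (a *\<^sub>R x) = \<bar>a\<bar> * p x" "p x \<ge> 0" for a x
    using b_scale[of a x x] b_scale[of a x "a *\<^sub>R x"] b_sym[of x "a *\<^sub>R x"]
    by (simp_all add: p_def b_nonneg real_sqrt_mult flip: mult.assoc)
  have dist0: "hdist H (T x) (T 0) = p x" for x
  proof -
    have "hadd H (T x) (hscale H (-1) (T 0)) = T x"
      using add[of x "(-1) *\<^sub>R 0"] scale[of "-1" 0] by simp
    then show ?thesis by (simp add: hdist_def hnorm_def Tc p_def b_def)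
  qed
  have "\<exists>d>0. \<forall>x. norm x < d \<longrightarrow> p x < 1"
  proof -
    have "open {x. T x \<in> MH.mball (T 0) 1}"
      using openin_continuous_map_preimage[OF contT MH.openin_mball[of "T 0" 1]] by simp
    moreover have "0 \<in> {x. T x \<in> MH.mball (T 0) 1}" using Tc by simp
    ultimately obtain d where "d > 0" "ball 0 d \<subseteq> {x. T x \<in> MH.mball (T 0) 1}"
      using openE by blast
    then show ?thesis
      by (intro exI[of _ d]) (auto simp: subset_iff MH.commute[of "T 0"] dist0)
  qed
  then obtain d where d: "d > 0" "\<And>x. norm x < d \<Longrightarrow> p x < 1" by blast
  have upper: "d * p x \<le> norm x" for x
    by (rule homogeneous_bound) (use p d in auto)
  have "\<exists>e>0. \<forall>x. p x < e \<longrightarrow> norm x < 1"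
  proof -
    have "openin (htopology H) {y \<in> hcarrier H. S y \<in> ball 0 1}"
      using openin_continuous_map_preimage[OF contS, of "ball 0 1"] by simp
    moreover have "T 0 \<in> {y \<in> hcarrier H. S y \<in> ball 0 1}" using Tc ST by simp
    ultimately obtain e where "e > 0" "MH.mball (T 0) e \<subseteq> {y \<in> hcarrier H. S y \<in> ball 0 1}"
      unfolding MH.openin_mtopology by meson
    then have "norm x < 1" if "p x < e" for x
      using that Tc ST[of x] by (force simp: subset_iff MH.commute[of "T 0"] dist0)
    with \<open>e > 0\<close> show ?thesis by blast
  qed
  then obtain e where e: "e > 0" "\<And>x. p x < e \<Longrightarrow> norm x < 1" by blast
  have lower: "e * norm x \<le> p x" for x
    by (rule homogeneous_bound) (use p e in auto)
  have CS: "\<bar>b x y\<bar> \<le> p x * p y" for x y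
  proof -
    have "(b x y)\<^sup>2 \<le> (p x * p y)\<^sup>2"
      using H.Cauchy_Schwarz[OF Tc[of x] Tc[of y]]
      by (simp add: p_def power_mult_distrib b_nonneg) (simp add: b_def)
    then show ?thesis using p(2) by (metis abs_le_square_iff abs_of_nonneg mult_nonneg_nonneg)
  qed
  have "bounded_bilinear b"
  proof
    show "\<exists>K. \<forall>x y. norm (b x y) \<le> norm x * norm y * K"
    proof (intro exI[of _ "1 / d\<^sup>2"] allI)
      fix x y
      have "(d * p x) * (d * p y) \<le> norm x * norm y"
        using upper p(2) d(1) by (intro mult_mono) auto
      then have "p x * p y \<le> norm x * norm y * (1 / d\<^sup>2)"
        using d(1) by (simp add: field_simps power2_eq_square)
      then show "norm (b x y) \<le> norm x * norm y * (1 / d\<^sup>2)" using CS[of x y] by simp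
    qed
  qed (metis b_add b_scale b_sym real_scaleR_def)+
  then interpret b: bounded_bilinear b .
  define A where "A = Blinfun b.prod_right"
  have A: "A x y = b x y" for x y
    by (simp add: A_def bounded_linear_Blinfun_apply b.bounded_linear_prod_right b.prod_right.rep_eq)
  moreover have "coercive A"
    unfolding coercive_def
  proof (intro exI[of _ "e\<^sup>2"] conjI allI)
    show "e\<^sup>2 * (norm x)\<^sup>2 \<le> A x x" for x
      using power_mono[OF lower[of x], of 2] e(1)
      by (simp add: A p_def b_nonneg power_mult_distrib)
  qed (use e in simp)
  ultimately show ?thesis using A b_sym by auto
qed

text \<open>
  Boundedness and coercivity of the form make its distance equivalent to that of the given norm, so
  the identity map is an isomorphism onto \<open>X\<close> with the form as inner product.
\<close>

lemma coercive_imp_hilbertian: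
  fixes A :: "'a::banach \<Rightarrow>\<^sub>L ('a \<Rightarrow>\<^sub>L real)"
  assumes sym: "\<And>x y. A x y = A y x" and "coercive A"
  shows "hilbertian TYPE('a)"
proof -
  obtain c where c: "c > 0" "\<And>x. c * (norm x)\<^sup>2 \<le> A x x" "\<And>x. A x x \<ge> 0"
    using \<open>coercive A\<close> by (rule coerciveE) blast
  define K :: "'a inner_space" where
    "K = \<lparr>hcarrier = UNIV, hadd = (+), hzero = 0, hscale = (*\<^sub>R), hinner = (\<lambda>x y. A x y)\<rparr>"
  have UK: "hcarrier K = UNIV" by (simp add: K_def)
  have K: "real_inner_product_space K"
  proof
    fix x assume "hinner K x x = 0"
    then show "x = hzero K" using c(2)[of x] c(1) by (simp add: K_def mult_le_0_iff)
  next
    fix x assume "x \<in> hcarrier K"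
    show "\<exists>y\<in>hcarrier K. hadd K x y = hzero K"
      by (intro bexI[of _ "- x"]) (auto simp: K_def)
  next
    show "hinner K x y = hinner K y x" for x y using sym[of x y] by (simp add: K_def)
  qed (auto simp: K_def blinfun.bilinear_simps c(3) algebra_simps)
  interpret K: real_inner_product_space K by (rule K)
  interpret MK: Metric_space "hcarrier K" "hdist K" by (rule K.Metric_space_hdist)
  have dK: "hdist K x y = sqrt (A (x - y) (x - y))" for x y
    by (simp add: hdist_def hnorm_def K_def)
  define s t where "s = sqrt c" and "t = sqrt (norm A) + 1"
  have st: "s > 0" "t > 0" using c(1) by (auto simp: s_def t_def add_nonneg_pos)
  have lower: "s * dist x y \<le> hdist K x y" for x y
    using real_sqrt_le_mono[OF c(2)[of "x - y"]]
    by (simp add: dK s_def dist_norm real_sqrt_mult)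
  have upper: "hdist K x y \<le> t * dist x y" for x y
  proof -
    have "A z z \<le> norm A * (norm z)\<^sup>2" for z
      using norm_blinfun[of "A z" z] mult_right_mono[OF norm_blinfun[of A z], of "norm z"]
      by (simp add: power2_eq_square mult.assoc)
    from real_sqrt_le_mono[OF this[of "x - y"]]
    have "hdist K x y \<le> sqrt (norm A) * dist x y"
      by (simp add: dK dist_norm real_sqrt_mult)
    then show ?thesis by (simp add: t_def distrib_right add_increasing2)
  qed
  have "openin (htopology K) U \<longleftrightarrow> open U" for U
  proof -
    have "(\<exists>r>0. MK.mball x r \<subseteq> U) \<longleftrightarrow> (\<exists>r>0. ball x r \<subseteq> U)" for x
    proof
      assume "\<exists>r>0. MK.mball x r \<subseteq> U"
      then obtain r where r: "r > 0" "MK.mball x r \<subseteq> U" by blast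
      have "ball x (r / t) \<subseteq> MK.mball x r"
      proof
        fix y assume "y \<in> ball x (r / t)"
        then have "t * dist x y < r" using st by (simp add: field_simps)
        then show "y \<in> MK.mball x r" using upper[of x y] UK unfolding MK.in_mball by simp
      qed
      then show "\<exists>r>0. ball x r \<subseteq> U" using r st by (intro exI[of _ "r / t"]) auto
    next
      assume "\<exists>r>0. ball x r \<subseteq> U"
      then obtain r where r: "r > 0" "ball x r \<subseteq> U" by blast
      have "MK.mball x (s * r) \<subseteq> ball x r"
      proof
        fix y assume "y \<in> MK.mball x (s * r)"
        then have "s * dist x y < s * r" using lower[of x y] by simp
        then show "y \<in> ball x r" using st by simp
      qed
      then show "\<exists>r>0. MK.mball x r \<subseteq> U" using r st by (intro exI[of _ "s * r"]) auto
    qed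
    then show ?thesis
      unfolding MK.openin_mtopology open_contains_ball by (simp add: UK Ball_def)
  qed
  then have top: "htopology K = euclidean" by (simp add: topology_eq)
  have "MK.mcomplete"
    unfolding MK.mcomplete_def
  proof (intro allI impI)
    fix \<sigma> assume \<sigma>: "MK.MCauchy \<sigma>"
    have "Cauchy \<sigma>"
    proof (rule metric_CauchyI)
      fix e :: real assume "e > 0"
      then obtain N where "\<And>i j. N \<le> i \<Longrightarrow> N \<le> j \<Longrightarrow> hdist K (\<sigma> i) (\<sigma> j) < s * e"
        using \<sigma> st unfolding MK.MCauchy_def by (meson mult_pos_pos)
      then have "s * dist (\<sigma> i) (\<sigma> j) < s * e" if "i \<ge> N" "j \<ge> N" for i j
        using lower that le_less_trans by blast
      then show "\<exists>M. \<forall>i\<ge>M. \<forall>j\<ge>M. dist (\<sigma> i) (\<sigma> j) < e" using st by auto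
    qed
    then obtain l where "\<sigma> \<longlonglongrightarrow> l" using Cauchy_convergent convergent_def by blast
    then show "\<exists>l. limitin (htopology K) \<sigma> l sequentially" by (auto simp: top)
  qed
  then have "real_hilbert_space K" by unfold_locales
  moreover have "hilbert_isomorphism K (\<lambda>x. x)"
    unfolding hilbert_isomorphism_def top
    by (auto simp: K_def homeomorphic_maps_def intro!: exI[of _ "\<lambda>x. x"])
  ultimately show ?thesis by (rule hilbertianI)
qed

theorem mainTheorem4:
  shows "hilbertian TYPE('a::banach) \<longleftrightarrow>
    (\<exists>A :: 'a \<Rightarrow>\<^sub>L ('a \<Rightarrow>\<^sub>L real). invertible_psd_operator A)"
proof
  assume "hilbertian TYPE('a)"
  then show "\<exists>A :: 'a \<Rightarrow>\<^sub>L ('a \<Rightarrow>\<^sub>L real). invertible_psd_operator A"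
    using hilbertian_imp_coercive coercive_imp_invertible_psd by blast
next
  assume "\<exists>A :: 'a \<Rightarrow>\<^sub>L ('a \<Rightarrow>\<^sub>L real). invertible_psd_operator A"
  then obtain A :: "'a \<Rightarrow>\<^sub>L ('a \<Rightarrow>\<^sub>L real)" where A: "invertible_psd_operator A" by blast
  then have "A x y = A y x" for x y by (simp add: invertible_psd_operator_def)
  then show "hilbertian TYPE('a)"
    using coercive_imp_hilbertian invertible_psd_imp_coercive[OF A] by blast
qed

end
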